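(* Let $g(x)=x_1x_2(x_1+x_2)$ on $\mathbb{R}^2$ with Gårding cone $\Gamma=\mathbb{R}^2_{>0}=\{x_1>0,\ x_2>0\}$. Then: (1) (Self-dual cone) $\Gamma^*=\mathbb{R}^2_{>0}$, or equivalently $\Gamma^0=\mathbb{R}^2_{\ge0}$. (2) (Gradient map) For $x\in\Gamma$, $$y=D_x\log g=\Bigl(\frac1{x_1}+\frac1{x_1+x_2},\ \frac1{x_2}+\frac1{x_1+x_2}\Bigr).$$ (3) (Inverse gradient map) For $y_1,y_2>0$ set $\Delta=y_1^2-y_1y_2+y_2^2$, which is $>0$. Then the point $x\in\Gamma$ with $D_x\log g=y$ is given by $$x_1=\frac{3}{2y_1-y_2+\sqrt\Delta},\qquad x_2=\frac{3}{2y_2-y_1+\sqrt\Delta},\qquad\text{and}\qquad x_1+x_2=\frac{3}{y_1+y_2-\sqrt\Delta}.$$ (4) (Dual function) For $y_1,y_2>0$, $$g^*(y)=\frac1{27}\bigl(2y_1-y_2+\sqrt\Delta\bigr)\bigl(2y_2-y_1+\sqrt\Delta\bigr)\bigl(y_1+y_2-\sqrt\Delta\bigr),$$ and $g^*(y)$ is not a polynomial.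
   Context: $\mathbb{R}^2$ is identified with its dual via the standard inner product. The polar of $\Gamma$ is $\Gamma^0=\{y\in\mathbb{R}^2:\langle y,x\rangle\ge0\ \forall x\in\Gamma\}$ and the open polar $\Gamma^*$ is its interior. The gradient map $F(x)=D_x\log g$ is a diffeomorphism from $\Gamma$ onto $\Gamma^*$, and the dual Gårding function is $g^*(y)=1/g(F^{-1}(y))$ for $y\in\Gamma^*$. *)

theory Defs
  imports "HOL-Analysis.Analysis" "HOL-Computational_Algebra.Polynomial"
begin

text \<open>
  A polynomial \<open>g\<close> on a Euclidean space is hyperbolic of degree \<open>m\<close> in direction \<open>a\<close> if it is
  homogeneous of degree \<open>m\<close>, positive at \<open>a\<close>, and each one-variable polynomial
  \<open>t \<mapsto> g (x + t a)\<close> has only real zeros, i.e. all its complex zeros are real.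
\<close>

definition hyperbolic :: "nat \<Rightarrow> ('a::euclidean_space \<Rightarrow> real) \<Rightarrow> 'a \<Rightarrow> bool" where
  "hyperbolic m g a \<longleftrightarrow>
     real_polynomial_function g \<and>
     (\<forall>c x. g (c *\<^sub>R x) = c ^ m * g x) \<and>
     g a > 0 \<and>
     (\<forall>x. \<exists>p::real poly. (\<forall>t. poly p t = g (x + t *\<^sub>R a)) \<and>
        (\<forall>z::complex. poly (map_poly complex_of_real p) z = 0 \<longrightarrow> z \<in> \<real>))"

definition garding_cone :: "('a::euclidean_space \<Rightarrow> real) \<Rightarrow> 'a \<Rightarrow> 'a set" where
  "garding_cone g a = connected_component_set {x. g x \<noteq> 0} a"

definition polar_cone :: "'a::real_inner set \<Rightarrow> 'a set" where
  "polar_cone C = {y. \<forall>x\<in>C. inner y x \<ge> 0}"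

definition open_polar :: "'a::real_inner set \<Rightarrow> 'a set" where
  "open_polar C = interior (polar_cone C)"

definition gradient :: "('a::real_inner \<Rightarrow> real) \<Rightarrow> 'a \<Rightarrow> 'a" where
  "gradient f x = (THE D. GDERIV f x :> D)"

definition gradient_map :: "('a::real_inner \<Rightarrow> real) \<Rightarrow> 'a \<Rightarrow> 'a" where
  "gradient_map g = gradient (\<lambda>x. ln (g x))"

text \<open>Only meaningful at points of \<open>open_polar C\<close>, where \<open>C\<close> is the cone of \<open>g\<close>.\<close>

definition dual_garding :: "('a::real_inner \<Rightarrow> real) \<Rightarrow> 'a set \<Rightarrow> 'a \<Rightarrow> real" where
  "dual_garding g C y = 1 / g (inv_into C (gradient_map g) y)"

definition cubic :: "real^2 \<Rightarrow> real" where
  "cubic x = x$1 * x$2 * (x$1 + x$2)"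

definition quadrant :: "(real^2) set" where
  "quadrant = {x. x$1 > 0 \<and> x$2 > 0}"

end

theory Submission
  imports Defs
begin

text \<open>
  Everything rests on the substitution \<open>a = 1/x\<^sub>1\<close>, \<open>b = 1/x\<^sub>2\<close>, \<open>c = 1/(x\<^sub>1 + x\<^sub>2)\<close>. These positive
  numbers satisfy the single relation \<open>c (a + b) = a b\<close>, and the gradient of \<open>log g\<close> is
  \<open>y = (a + c, b + c)\<close>. The relation turns the quadratic form \<open>\<Delta>\<close> into a perfect square,
  \<open>\<Delta> = (a + b - c)\<^sup>2\<close>. Hence \<open>y\<close> determines \<open>a + b - c = \<surd>\<Delta>\<close>, and \<open>a\<close>, \<open>b\<close>, \<open>c\<close> are obtained
  from \<open>y\<close> and \<open>\<surd>\<Delta>\<close> by solving a linear system (\<open>gradient_preimage_formulas\<close>).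
  Conversely, for positive \<open>y\<close> the solutions of this linear system are positive and satisfy the
  relation, so they come from a point of the quadrant (\<open>gradient_map_cubic_surj\<close>).
  The dual function is \<open>1/g(x) = a b c\<close>.

  Expanding this product gives \<open>27 g\<^sup>*(y) = r(y) + 2 \<Delta>\<^sup>3\<^sup>/\<^sup>2\<close> with \<open>r\<close> a polynomial.
  So if \<open>g\<^sup>*\<close> were a polynomial, then so would be \<open>\<Delta>\<^sup>3\<^sup>/\<^sup>2\<close>; but \<open>\<Delta>\<^sup>3\<close>, restricted to the line
  \<open>y = (1, t)\<close>, has complex zeros of order 3 and is therefore not a square
  (\<open>cubed_quadratic_not_square\<close>).

  The cubic is a product of three linear forms that are positive on the quadrant. This makes it
  hyperbolic there, and its cone is the quadrant because the forms \<open>x\<^sub>1\<close> and \<open>x\<^sub>2\<close> cannot change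
  sign on a connected set where the cubic does not vanish.
\<close>

section \<open>Hyperbolicity and the cone\<close>

lemma real_zero_of_real_linear_factor:
  fixes c d :: real and z :: complex
  assumes "d \<noteq> 0" "of_real c + z * of_real d = 0"
  shows "z \<in> \<real>"
proof -
  have "z = of_real (- c / d)"
    using assms by (simp add: field_simps add_eq_0_iff)
  then show ?thesis
    by (metis Reals_of_real)
qed

lemma map_poly_of_real_mult:
  fixes p q :: "real poly"
  shows "map_poly complex_of_real (p * q) = map_poly complex_of_real p * map_poly complex_of_real q"
  by (rule poly_eqI) (simp add: coeff_map_poly coeff_mult)

lemma hyperbolic_cubic:
  assumes "a \<in> quadrant"
  shows "hyperbolic 3 cubic a"
proof -
  have pos: "a$1 > 0" "a$2 > 0"
    using assms by (auto simp: quadrant_def)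
  have "real_polynomial_function (\<lambda>x::real^2. x$i)" for i
    by (rule real_polynomial_function.intros(1)[OF bounded_linear_vec_nth])
  then have "real_polynomial_function cubic"
    unfolding cubic_def[abs_def] by (intro real_polynomial_function.intros(3,4))
  moreover have "cubic (c *\<^sub>R x) = c ^ 3 * cubic x" for c x
    by (simp add: cubic_def power3_eq_cube algebra_simps)
  moreover have "cubic a > 0"
    using pos by (simp add: cubic_def)
  moreover have "\<exists>p. (\<forall>t. poly p t = cubic (x + t *\<^sub>R a)) \<and>
        (\<forall>z::complex. poly (map_poly complex_of_real p) z = 0 \<longrightarrow> z \<in> \<real>)" for x
  proof (intro exI conjI allI impI)
    \<comment> \<open>The restriction to a line in direction \<open>a\<close> splits into real linear factors.\<close>
    let ?p = "[:x$1, a$1:] * [:x$2, a$2:] * [:x$1 + x$2, a$1 + a$2:]"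
    show "poly ?p t = cubic (x + t *\<^sub>R a)" for t
      by (simp add: cubic_def algebra_simps)
    fix z :: complex
    assume "poly (map_poly complex_of_real ?p) z = 0"
    then have "(of_real (x$1) + z * of_real (a$1)) * (of_real (x$2) + z * of_real (a$2)) *
        (of_real (x$1 + x$2) + z * of_real (a$1 + a$2)) = 0"
      by (simp add: map_poly_of_real_mult map_poly_pCons del: mult_pCons_left mult_pCons_right)
    then show "z \<in> \<real>"
      using pos real_zero_of_real_linear_factor[of "a$1" "x$1" z]
        real_zero_of_real_linear_factor[of "a$2" "x$2" z]
        real_zero_of_real_linear_factor[of "a$1 + a$2" "x$1 + x$2" z]
      by auto
  qed
  ultimately show ?thesis
    by (simp add: hyperbolic_def)
qed

lemma convex_quadrant: "convex quadrant"
proof -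
  have quadrant: "quadrant = {x. x$1 > 0} \<inter> {x. x$2 > 0}"
    by (auto simp: quadrant_def)
  have "convex {x::real^2. x$k > 0}" for k
    using convex_halfspace_gt[of 0 "axis k 1 :: real^2"] by (simp add: inner_axis')
  then show ?thesis
    unfolding quadrant by (intro convex_Int)
qed

text \<open>
  The coordinate functions divide the cubic, so by the intermediate value theorem neither can
  become nonpositive on the component of a point where it is positive.
\<close>

lemma garding_cone_cubic:
  assumes "a \<in> quadrant"
  shows "garding_cone cubic a = quadrant"
proof
  have "quadrant \<subseteq> {x. cubic x \<noteq> 0}"
    by (auto simp: quadrant_def cubic_def)
  then show "quadrant \<subseteq> garding_cone cubic a"
    unfolding garding_cone_def
    using assms convex_connected[OF convex_quadrant] by (intro connected_component_maximal)
next
  let ?C = "garding_cone cubic a"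
  have sub: "?C \<subseteq> {x. cubic x \<noteq> 0}"
    unfolding garding_cone_def by (rule connected_component_subset)
  have con: "connected ?C"
    unfolding garding_cone_def by (rule connected_connected_component)
  have "a \<in> {x. cubic x \<noteq> 0}"
    using assms by (auto simp: quadrant_def cubic_def)
  then have a: "a \<in> ?C"
    by (simp add: garding_cone_def)
  show "?C \<subseteq> quadrant"
  proof
    fix z assume z: "z \<in> ?C"
    have "z$k > 0" if k: "a$k > 0" "\<And>w. w$k = 0 \<Longrightarrow> cubic w = 0" for k
    proof (rule ccontr)
      assume "\<not> z$k > 0"
      then obtain w where "w \<in> ?C" "w$k = 0"
        using connected_ivt_component_cart[OF con z a, of k 0] k(1) by auto
      then show False
        using k(2) sub by auto
    qed
    then show "z \<in> quadrant"
      using assms by (auto simp: quadrant_def cubic_def)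
  qed
qed

section \<open>Self-duality of the quadrant\<close>

lemma polar_cone_quadrant: "polar_cone quadrant = {y. y$1 \<ge> 0 \<and> y$2 \<ge> 0}"
proof
  show "{y. y$1 \<ge> 0 \<and> y$2 \<ge> 0} \<subseteq> polar_cone quadrant"
    by (auto simp: polar_cone_def quadrant_def inner_vec_def sum_2)
next
  have *: "u \<ge> 0" if "\<And>s. s > 0 \<Longrightarrow> u * s + v \<ge> 0" for u v :: real
  proof (rule ccontr)
    assume u: "\<not> u \<ge> 0"
    \<comment> \<open>At this point the first term equals \<open>- (\<bar>v\<bar> + 1)\<close> and outweighs \<open>v\<close>.\<close>
    then have "(\<bar>v\<bar> + 1) / - u > 0"
      by (intro divide_pos_pos) auto
    from that[OF this] u show False
      by auto
  qed
  show "polar_cone quadrant \<subseteq> {y. y$1 \<ge> 0 \<and> y$2 \<ge> 0}"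
  proof
    fix y assume "y \<in> polar_cone quadrant"
    then have y: "y$1 * s + y$2 * t \<ge> 0" if "s > 0" "t > 0" for s t
    proof -
      have "vector [s, t] \<in> quadrant"
        using that by (simp add: quadrant_def)
      with \<open>y \<in> polar_cone quadrant\<close> have "inner y (vector [s, t]) \<ge> 0"
        by (auto simp: polar_cone_def)
      then show ?thesis
        by (simp add: inner_vec_def sum_2)
    qed
    have "y$1 * s + y$2 \<ge> 0" "y$2 * s + y$1 \<ge> 0" if "s > 0" for s
      using y[of s 1] y[of 1 s] that by (simp_all add: add.commute)
    then show "y \<in> {y. y$1 \<ge> 0 \<and> y$2 \<ge> 0}"
      using *[of "y$1" "y$2"] *[of "y$2" "y$1"] by blast
  qed
qed

lemma open_polar_quadrant: "open_polar quadrant = quadrant"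
proof -
  have "{y::real^2. y$1 \<ge> 0 \<and> y$2 \<ge> 0} = {y. y$1 \<ge> 0} \<inter> {y. y$2 \<ge> 0}"
    by auto
  then have "interior (polar_cone quadrant) = {y. y$1 > 0} \<inter> {y. y$2 > 0}"
    unfolding polar_cone_quadrant by simp
  then show ?thesis
    by (auto simp: open_polar_def quadrant_def)
qed

section \<open>The gradient map and its inverse\<close>

lemma gradient_eqI:
  assumes "GDERIV f x :> D"
  shows "gradient f x = D"
  unfolding gradient_def
proof (rule the_equality[where P = "\<lambda>D. GDERIV f x :> D", OF assms])
  fix E assume "GDERIV f x :> E"
  then have "(\<lambda>h. inner h E) = (\<lambda>h. inner h D)"
    using assms has_derivative_unique unfolding gderiv_def by blast
  then have "inner h E = inner h D" for h
    by meson
  from this[of "E - D"] have "inner (E - D) (E - D) = 0"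
    by (simp add: inner_diff_right)
  then show "E = D"
    by simp
qed

lemma gderiv_ln_cubic:
  assumes "x \<in> quadrant"
  shows "GDERIV (\<lambda>x. ln (cubic x)) x :>
    vector [1 / x$1 + 1 / (x$1 + x$2), 1 / x$2 + 1 / (x$1 + x$2)]"
proof -
  have pos: "x$1 > 0" "x$2 > 0"
    using assms by (auto simp: quadrant_def)
  have coord [derivative_intros]: "((\<lambda>x::real^2. x$i) has_derivative (\<lambda>h. h$i)) (at x)" for i
    by (rule bounded_linear_imp_has_derivative[OF bounded_linear_vec_nth])
  have "(cubic has_derivative (\<lambda>h. h$1 * x$2 * (x$1 + x$2) + x$1 * h$2 * (x$1 + x$2) +
      x$1 * x$2 * (h$1 + h$2))) (at x)"
    unfolding cubic_def[abs_def] by (auto intro!: derivative_eq_intros simp: algebra_simps)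
  moreover have "cubic x > 0"
    using pos by (simp add: cubic_def)
  ultimately have "((\<lambda>x. ln (cubic x)) has_derivative (\<lambda>h. (h$1 * x$2 * (x$1 + x$2) +
      x$1 * h$2 * (x$1 + x$2) + x$1 * x$2 * (h$1 + h$2)) / cubic x)) (at x)"
    by (auto intro!: derivative_eq_intros simp: field_simps)
  moreover have "(h$1 * x$2 * (x$1 + x$2) + x$1 * h$2 * (x$1 + x$2) + x$1 * x$2 * (h$1 + h$2)) /
      cubic x = inner h (vector [1 / x$1 + 1 / (x$1 + x$2), 1 / x$2 + 1 / (x$1 + x$2)])"
    for h :: "real^2"
  proof -
    have "x$1 + x$2 \<noteq> 0" "x$1 \<noteq> 0" "x$2 \<noteq> 0"
      using pos by auto
    then show ?thesis
      by (simp add: cubic_def inner_vec_def sum_2 divide_simps) (simp add: algebra_simps)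
  qed
  ultimately show ?thesis
    by (simp add: gderiv_def)
qed

lemma gradient_map_cubic:
  assumes "x \<in> quadrant"
  shows "gradient_map cubic x =
    vector [1 / x$1 + 1 / (x$1 + x$2), 1 / x$2 + 1 / (x$1 + x$2)]"
  unfolding gradient_map_def by (rule gradient_eqI[OF gderiv_ln_cubic[OF assms]])

lemma discriminant_pos:
  fixes u v :: real
  assumes "u > 0" "v > 0"
  shows "u\<^sup>2 - u * v + v\<^sup>2 > 0"
proof -
  have "u\<^sup>2 - u * v + v\<^sup>2 = (u - v)\<^sup>2 + u * v"
    by (simp add: power2_eq_square algebra_simps)
  also have "\<dots> > 0"
    using assms by (intro add_nonneg_pos) auto
  finally show ?thesis .
qed

text \<open>
  The relation \<open>c (a + b) = a b\<close> cancels the mixed terms: both sides, squared, equal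
  \<open>a\<^sup>2 + b\<^sup>2 + c\<^sup>2\<close>. The sign is right because the relation forces \<open>c < a\<close>.
\<close>

lemma sqrt_discriminant:
  fixes a b c :: real
  assumes "a > 0" "b > 0" "c > 0" and rel: "c * (a + b) = a * b"
  shows "sqrt ((a + c)\<^sup>2 - (a + c) * (b + c) + (b + c)\<^sup>2) = a + b - c"
proof (rule real_sqrt_unique)
  have "(a + b - c)\<^sup>2 = a\<^sup>2 + b\<^sup>2 + c\<^sup>2 + 2 * (a * b - c * (a + b))"
    by (simp add: power2_eq_square algebra_simps)
  moreover have "(a + c)\<^sup>2 - (a + c) * (b + c) + (b + c)\<^sup>2 = a\<^sup>2 + b\<^sup>2 + c\<^sup>2 + (c * (a + b) - a * b)"
    by (simp add: power2_eq_square algebra_simps)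
  ultimately show "(a + b - c)\<^sup>2 = (a + c)\<^sup>2 - (a + c) * (b + c) + (b + c)\<^sup>2"
    using rel by simp
  have "c * b < a * b"
    using assms by (simp flip: rel add: distrib_left)
  then show "0 \<le> a + b - c"
    using assms by simp
qed

lemma gradient_preimage_formulas:
  assumes x: "x \<in> quadrant" and y: "gradient_map cubic x = y"
    and \<Delta>: "\<Delta> = (y$1)\<^sup>2 - y$1 * y$2 + (y$2)\<^sup>2"
  shows "x$1 = 3 / (2 * y$1 - y$2 + sqrt \<Delta>)"
    and "x$2 = 3 / (2 * y$2 - y$1 + sqrt \<Delta>)"
    and "x$1 + x$2 = 3 / (y$1 + y$2 - sqrt \<Delta>)"
proof -
  define a b c where "a = 1 / x$1" and "b = 1 / x$2" and "c = 1 / (x$1 + x$2)"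
  note abc = a_def b_def c_def
  have pos: "x$1 > 0" "x$2 > 0"
    using x by (auto simp: quadrant_def)
  then have "x$1 + x$2 > 0"
    by simp
  then have "a > 0" "b > 0" "c > 0" "c * (a + b) = a * b"
    using pos by (auto simp: abc field_simps)
  from sqrt_discriminant[OF this] have "sqrt \<Delta> = a + b - c"
    and "y$1 = a + c" "y$2 = b + c"
    using \<Delta> gradient_map_cubic[OF x] y by (auto simp: abc)
  then have "2 * y$1 - y$2 + sqrt \<Delta> = 3 * a" "2 * y$2 - y$1 + sqrt \<Delta> = 3 * b"
    "y$1 + y$2 - sqrt \<Delta> = 3 * c"
    by simp_all
  then show "x$1 = 3 / (2 * y$1 - y$2 + sqrt \<Delta>)" "x$2 = 3 / (2 * y$2 - y$1 + sqrt \<Delta>)"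
    "x$1 + x$2 = 3 / (y$1 + y$2 - sqrt \<Delta>)"
    by (simp_all add: abc)
qed

text \<open>The positivity that makes the candidate values of \<open>1/x\<^sub>1\<close> and \<open>1/x\<^sub>2\<close> admissible. Where the linear
  part is negative, its square falls short of \<open>\<Delta>\<close> by \<open>3 u (v - u)\<close>.\<close>

lemma inverse_coordinate_pos:
  fixes u v :: real
  assumes "u > 0" "v > 0"
  shows "2 * u - v + sqrt (u\<^sup>2 - u * v + v\<^sup>2) > 0"
proof (cases "v < 2 * u")
  case True
  then show ?thesis
    using discriminant_pos[OF assms] by (simp add: add_pos_pos)
next
  case False
  have "u\<^sup>2 - u * v + v\<^sup>2 - (v - 2 * u)\<^sup>2 = 3 * (u * (v - u))"
    by (simp add: power2_eq_square algebra_simps)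
  moreover have "u * (v - u) > 0"
    using False assms by (intro mult_pos_pos) auto
  ultimately have "v - 2 * u < sqrt (u\<^sup>2 - u * v + v\<^sup>2)"
    by (intro real_less_rsqrt) linarith
  then show ?thesis
    by simp
qed

text \<open>
  The numbers \<open>a\<close>, \<open>b\<close>, \<open>c\<close> solve \<open>a + c = y\<^sub>1\<close>, \<open>b + c = y\<^sub>2\<close>, \<open>a + b - c = \<surd>\<Delta>\<close>. The value of \<open>\<Delta>\<close> is
  exactly what yields \<open>c (a + b) = a b\<close>, so \<open>c\<close> is the reciprocal of \<open>1/a + 1/b\<close>, as required of a
  gradient at \<open>(1/a, 1/b)\<close>.
\<close>

lemma gradient_map_cubic_surj:
  assumes y: "y$1 > 0" "y$2 > 0"
  shows "\<exists>x\<in>quadrant. gradient_map cubic x = y"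
proof -
  define s where "s = sqrt ((y$1)\<^sup>2 - y$1 * y$2 + (y$2)\<^sup>2)"
  define a b c where "a = (2 * y$1 - y$2 + s) / 3" and "b = (2 * y$2 - y$1 + s) / 3"
    and "c = (y$1 + y$2 - s) / 3"
  have s2: "s\<^sup>2 = (y$1)\<^sup>2 - y$1 * y$2 + (y$2)\<^sup>2"
    using discriminant_pos[OF y] by (simp add: s_def)
  have a: "a > 0"
    using inverse_coordinate_pos[OF y] by (simp add: a_def s_def)
  have b: "b > 0"
    using inverse_coordinate_pos[OF y(2) y(1)] by (simp add: b_def s_def algebra_simps)
  have "9 * (c * (a + b)) - 9 * (a * b) = 3 * ((y$1)\<^sup>2 - y$1 * y$2 + (y$2)\<^sup>2 - s\<^sup>2)"
    by (simp add: a_def b_def c_def power2_eq_square field_simps)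
  then have rel: "c * (a + b) = a * b"
    using s2 by simp
  have c: "1 / (1 / a + 1 / b) = c"
    using a b rel by (simp add: field_simps)
  define x :: "real^2" where "x = vector [1 / a, 1 / b]"
  have x: "x \<in> quadrant"
    using a b by (simp add: x_def quadrant_def)
  moreover have "gradient_map cubic x = vector [a + c, b + c]"
    unfolding gradient_map_cubic[OF x] using c by (simp add: x_def)
  moreover have "vector [a + c, b + c] = y"
    by (simp add: vec_eq_iff forall_2 a_def b_def c_def field_simps)
  ultimately show ?thesis
    by auto
qed

lemma inj_on_gradient_map_cubic: "inj_on (gradient_map cubic) quadrant"
proof (rule inj_onI)
  fix x z assume "x \<in> quadrant" "z \<in> quadrant" "gradient_map cubic x = gradient_map cubic z"
  then show "x = z"
    using gradient_preimage_formulas(1,2)[of x, OF _ refl refl]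
      gradient_preimage_formulas(1,2)[of z, OF _ refl refl]
    by (simp add: vec_eq_iff forall_2)
qed

section \<open>The dual function\<close>

lemma dual_garding_cubic:
  assumes y: "y$1 > 0" "y$2 > 0" and \<Delta>: "\<Delta> = (y$1)\<^sup>2 - y$1 * y$2 + (y$2)\<^sup>2"
  shows "dual_garding cubic quadrant y =
    1 / 27 * (2 * y$1 - y$2 + sqrt \<Delta>) * (2 * y$2 - y$1 + sqrt \<Delta>) * (y$1 + y$2 - sqrt \<Delta>)"
proof -
  obtain x where x: "x \<in> quadrant" "gradient_map cubic x = y"
    using gradient_map_cubic_surj[OF y] by blast
  have "inv_into quadrant (gradient_map cubic) y = x"
    using inv_into_f_f[OF inj_on_gradient_map_cubic x(1)] x(2) by simp
  then have "dual_garding cubic quadrant y = 1 / (x$1 * x$2 * (x$1 + x$2))"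
    by (simp add: dual_garding_def cubic_def)
  then show ?thesis
    unfolding gradient_preimage_formulas(3)[OF x \<Delta>]
    unfolding gradient_preimage_formulas(1,2)[OF x \<Delta>] by simp
qed

text \<open>
  The expansion isolates the irrational part of the dual function: modulo \<open>s\<^sup>2 = \<Delta>\<close>, the factor of
  \<open>s\<close> is itself a multiple of \<open>\<Delta>\<close>.
\<close>

lemma dual_cubic_expansion:
  fixes u v s :: real
  assumes "s\<^sup>2 = u\<^sup>2 - u * v + v\<^sup>2"
  shows "(2 * u - v + s) * (2 * v - u + s) * (u + v - s) =
    (u + v) * (5 * u * v - 2 * u\<^sup>2 - 2 * v\<^sup>2) + 2 * s ^ 3"
proof -
  have "(2 * u - v + s) * (2 * v - u + s) * (u + v - s) -
      ((u + v) * (5 * u * v - 2 * u\<^sup>2 - 2 * v\<^sup>2) + 2 * s ^ 3) =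
      3 * s * (u\<^sup>2 - u * v + v\<^sup>2 - s\<^sup>2)"
    by (simp add: power2_eq_square power3_eq_cube algebra_simps)
  then show ?thesis
    using assms by simp
qed

text \<open>Restricting to a line brings the question of polynomiality down to one variable.\<close>

lemma real_polynomial_function_on_line:
  fixes p :: "'a::real_normed_vector \<Rightarrow> real"
  assumes "real_polynomial_function p"
  shows "\<exists>q. \<forall>t. poly q t = p (u + t *\<^sub>R v)"
  using assms
proof induction
  case (linear f)
  then interpret bounded_linear f .
  have "\<forall>t. poly [:f u, f v:] t = f (u + t *\<^sub>R v)"
    by (simp add: add scaleR)
  then show ?case ..
next
  case (const c)
  have "\<forall>t. poly [:c:] t = c"
    by simp
  then show ?case ..
next
  case (add f g)
  then show ?case
    by (metis poly_add)
next
  case (mult f g)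
  then show ?case
    by (metis poly_mult)
qed

text \<open>
  Over the complex numbers \<open>1 - t + t\<^sup>2\<close> has two distinct zeros, so each is a zero of order 3 of the
  cube; the zeros of a square have even order.
\<close>

lemma cubed_quadratic_not_square:
  fixes q :: "real poly"
  assumes q: "\<And>t. t > 0 \<Longrightarrow> (poly q t)\<^sup>2 = (1 - t + t\<^sup>2) ^ 3"
  shows False
proof -
  have "q\<^sup>2 = [:1, -1, 1:] ^ 3"
  proof (rule ccontr)
    assume "q\<^sup>2 \<noteq> [:1, -1, 1:] ^ 3"
    then have "finite {t. poly (q\<^sup>2 - [:1, -1, 1:] ^ 3) t = 0}"
      by (intro poly_roots_finite) simp
    moreover have "{0<..} \<subseteq> {t. poly (q\<^sup>2 - [:1, -1, 1:] ^ 3) t = 0}"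
      using q by (auto simp: power2_eq_square algebra_simps)
    ultimately show False
      using finite_subset infinite_Ioi by blast
  qed
  then have "map_poly complex_of_real (q\<^sup>2) = map_poly complex_of_real ([:1, -1, 1:] ^ 3)"
    by simp
  then have eq: "(map_poly complex_of_real q)\<^sup>2 = [:1, -1, 1:] ^ 3"
    by (simp add: power2_eq_square power3_eq_cube map_poly_of_real_mult map_poly_pCons
        del: mult_pCons_left mult_pCons_right)
  define w where "w = Complex (1/2) (sqrt 3 / 2)"
  have "[:1, -1, 1:] = [:- w, 1:] * [:- cnj w, 1:]"
    by (simp add: w_def complex_eq_iff power2_eq_square)
  moreover have "w \<noteq> cnj w"
    by (simp add: w_def complex_eq_iff)
  moreover have "order w [:- w, 1:] = 1"
    using order_power_n_n[of w 1] by simp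
  ultimately have "order w [:1, -1, 1:] = 1"
    by (simp add: order_mult order_0I del: mult_pCons_left mult_pCons_right)
  then have "order w ([:1, -1, 1:] ^ 3) = 3"
    by (simp add: power3_eq_cube order_mult del: mult_pCons_left mult_pCons_right)
  moreover have "map_poly complex_of_real q \<noteq> 0"
    using eq by auto
  then have "order w ((map_poly complex_of_real q)\<^sup>2) = 2 * order w (map_poly complex_of_real q)"
    by (simp add: power2_eq_square order_mult)
  ultimately have "even (3::nat)"
    by (metis eq dvd_triv_left)
  then show False
    by simp
qed

lemma dual_garding_cubic_not_polynomial:
  assumes "real_polynomial_function p"
    and p: "\<And>y. y \<in> quadrant \<Longrightarrow> p y = dual_garding cubic quadrant y"
  shows False
proof -
  obtain q where q: "poly q t = p (vector [1, 0] + t *\<^sub>R vector [0, 1])" for t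
    using real_polynomial_function_on_line[OF assms(1)] by metis
  \<comment> \<open>On the line \<open>y = (1, t)\<close> the expansion expresses \<open>\<Delta>\<^sup>3\<^sup>/\<^sup>2\<close> by this polynomial.\<close>
  define r where "r = smult (1/2) (smult 27 q - [:1, 1:] * [:-2, 5, -2:])"
  have "(poly r t)\<^sup>2 = (1 - t + t\<^sup>2) ^ 3" if t: "t > 0" for t
  proof -
    let ?y = "vector [1, t] :: real^2"
    define s where "s = sqrt (1 - t + t\<^sup>2)"
    have s2: "s\<^sup>2 = 1 - t + t\<^sup>2"
      using discriminant_pos[of 1 t] t by (simp add: s_def)
    have "poly q t = p ?y"
      unfolding q by (rule arg_cong[of _ _ p]) (simp add: vec_eq_iff forall_2)
    also have "\<dots> = dual_garding cubic quadrant ?y"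
      using t by (intro p) (simp add: quadrant_def)
    also have "\<dots> = 1 / 27 * ((2 - t + s) * (2 * t - 1 + s) * (1 + t - s))"
      using dual_garding_cubic[of ?y, OF _ _ refl] t by (simp add: s_def)
    also have "\<dots> = 1 / 27 * ((1 + t) * (5 * t - 2 - 2 * t\<^sup>2) + 2 * s ^ 3)"
      using dual_cubic_expansion[of s 1 t] s2 by simp
    finally have "poly r t = s ^ 3"
      by (simp add: r_def power2_eq_square algebra_simps)
    then have "(poly r t)\<^sup>2 = (s\<^sup>2) ^ 3"
      by (simp flip: power_mult)
    then show ?thesis
      using s2 by simp
  qed
  then show False
    by (rule cubed_quadratic_not_square)
qed

section \<open>The cubic, its cone and its dual function\<close>

theorem proposition16p2:
  shows "(\<forall>a\<in>quadrant. hyperbolic 3 cubic a \<and> garding_cone cubic a = quadrant) \<and>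
    (open_polar quadrant = quadrant \<and> polar_cone quadrant = {y. y$1 \<ge> 0 \<and> y$2 \<ge> 0}) \<and>
    (\<forall>x\<in>quadrant.
       GDERIV (\<lambda>x. ln (cubic x)) x :> gradient_map cubic x \<and>
       gradient_map cubic x =
         vector [1 / x$1 + 1 / (x$1 + x$2), 1 / x$2 + 1 / (x$1 + x$2)]) \<and>
    (\<forall>y::real^2. y$1 > 0 \<and> y$2 > 0 \<longrightarrow>
       (let \<Delta> = (y$1)^2 - y$1 * y$2 + (y$2)^2 in
          \<Delta> > 0 \<and>
          (\<exists>!x. x \<in> quadrant \<and> gradient_map cubic x = y) \<and>
          (\<forall>x\<in>quadrant. gradient_map cubic x = y \<longrightarrow>
             x$1 = 3 / (2 * y$1 - y$2 + sqrt \<Delta>) \<and>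
             x$2 = 3 / (2 * y$2 - y$1 + sqrt \<Delta>) \<and>
             x$1 + x$2 = 3 / (y$1 + y$2 - sqrt \<Delta>)))) \<and>
    (\<forall>y::real^2. y$1 > 0 \<and> y$2 > 0 \<longrightarrow>
       (let \<Delta> = (y$1)^2 - y$1 * y$2 + (y$2)^2 in
          dual_garding cubic quadrant y =
            1 / 27 * (2 * y$1 - y$2 + sqrt \<Delta>) * (2 * y$2 - y$1 + sqrt \<Delta>)
              * (y$1 + y$2 - sqrt \<Delta>))) \<and>
    \<not> (\<exists>p. real_polynomial_function p \<and>
          (\<forall>y\<in>open_polar quadrant. p y = dual_garding cubic quadrant y))"
proof (intro conjI ballI allI impI)
  show "hyperbolic 3 cubic a" "garding_cone cubic a = quadrant" if "a \<in> quadrant" for a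
    using that by (rule hyperbolic_cubic, rule garding_cone_cubic)
  show "open_polar quadrant = quadrant" "polar_cone quadrant = {y. y$1 \<ge> 0 \<and> y$2 \<ge> 0}"
    by (rule open_polar_quadrant, rule polar_cone_quadrant)
next
  fix x assume x: "x \<in> quadrant"
  show "gradient_map cubic x =
      vector [1 / x$1 + 1 / (x$1 + x$2), 1 / x$2 + 1 / (x$1 + x$2)]"
    using x by (rule gradient_map_cubic)
  then show "GDERIV (\<lambda>x. ln (cubic x)) x :> gradient_map cubic x"
    using gderiv_ln_cubic[OF x] by simp
next
  fix y :: "real^2" assume "y$1 > 0 \<and> y$2 > 0"
  then have y: "y$1 > 0" "y$2 > 0"
    by auto
  have "\<exists>!x. x \<in> quadrant \<and> gradient_map cubic x = y"
    using gradient_map_cubic_surj[OF y] inj_on_gradient_map_cubic by (auto dest: inj_onD)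
  then show "let \<Delta> = (y$1)^2 - y$1 * y$2 + (y$2)^2 in
      \<Delta> > 0 \<and>
      (\<exists>!x. x \<in> quadrant \<and> gradient_map cubic x = y) \<and>
      (\<forall>x\<in>quadrant. gradient_map cubic x = y \<longrightarrow>
         x$1 = 3 / (2 * y$1 - y$2 + sqrt \<Delta>) \<and>
         x$2 = 3 / (2 * y$2 - y$1 + sqrt \<Delta>) \<and>
         x$1 + x$2 = 3 / (y$1 + y$2 - sqrt \<Delta>))"
    unfolding Let_def
    using discriminant_pos[OF y] gradient_preimage_formulas[OF _ _ refl] by blast
  show "let \<Delta> = (y$1)^2 - y$1 * y$2 + (y$2)^2 in
      dual_garding cubic quadrant y =
        1 / 27 * (2 * y$1 - y$2 + sqrt \<Delta>) * (2 * y$2 - y$1 + sqrt \<Delta>)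
          * (y$1 + y$2 - sqrt \<Delta>)"
    unfolding Let_def using dual_garding_cubic[OF y refl] .
next
  show "\<not> (\<exists>p. real_polynomial_function p \<and>
      (\<forall>y\<in>open_polar quadrant. p y = dual_garding cubic quadrant y))"
    using dual_garding_cubic_not_polynomial unfolding open_polar_quadrant by blast
qed

end
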